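(* Let $\lambda\ge 2$ be a fixed integer, and let $\kappa_{n,\lambda}$ denote the minimum number of $(n+1)$-permutations needed to cover each $n$-permutation $\lambda$ times. Then, as $n\to\infty$, $$\kappa_{n,\lambda}\le\frac{(n+1)!}{n^2}\bigl(\log n+(\lambda-1)\log\log n+O(1)\bigr).$$
   Context: $S_n$ is the set of all permutations of $[n]=\{1,2,\ldots,n\}$, written as words; its elements are called $n$-permutations. A permutation $\rho\in S_{n+1}$ covers $\pi\in S_n$ if $\rho$ has a (not necessarily contiguous) subsequence of length $n$ that is order-isomorphic to $\pi$. The number $\kappa_{n,\lambda}$ is the smallest cardinality of a set $\mathcal{A}\subseteq S_{n+1}$ such that every $\pi\in S_n$ is covered by at least $\lambda$ distinct elements of $\mathcal{A}$ (such a set exists for all sufficiently large $n$). $\log$ is the natural logarithm; the constant implied by $O(1)$ may depend on $\lambda$. *)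

theory Defs
  imports
    "HOL-Analysis.Analysis"
    "HOL-Library.Sublist"
    "HOL-Library.Landau_Symbols"
    "HOL-Combinatorics.Multiset_Permutations"
begin

abbreviation n_permutations :: "nat \<Rightarrow> nat list set" where
  "n_permutations n \<equiv> permutations_of_set {1..n}"

definition order_isomorphic :: "nat list \<Rightarrow> nat list \<Rightarrow> bool" where
  "order_isomorphic xs ys \<longleftrightarrow>
     length xs = length ys \<and>
     (\<forall>i < length xs. \<forall>j < length xs. xs ! i < xs ! j \<longleftrightarrow> ys ! i < ys ! j)"

definition covers :: "nat list \<Rightarrow> nat list \<Rightarrow> bool" where
  "covers \<rho> \<pi> \<longleftrightarrow> (\<exists>xs. subseq xs \<rho> \<and> order_isomorphic xs \<pi>)"

definition covering_family :: "nat \<Rightarrow> nat \<Rightarrow> nat list set \<Rightarrow> bool" where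
  "covering_family n l \<A> \<longleftrightarrow>
     \<A> \<subseteq> n_permutations (n + 1) \<and>
     (\<forall>\<pi> \<in> n_permutations n. l \<le> card {\<rho> \<in> \<A>. covers \<rho> \<pi>})"

(* For l > n^2 + 1 no covering family exists and the value is
   unspecified; covering_family_exists below gives existence for l \<le> n + 1. *)
definition kappa :: "nat \<Rightarrow> nat \<Rightarrow> nat" where
  "kappa n l = (LEAST k. \<exists>\<A>. covering_family n l \<A> \<and> card \<A> = k)"

lemma covering_family_exists:
  assumes "l \<le> n + 1"
  shows "covering_family n l (n_permutations (n + 1))"
  unfolding covering_family_def
proof (intro conjI ballI order_refl)
  fix \<pi> assume p: "\<pi> \<in> n_permutations n"
  then have sp: "set \<pi> = {1..n}" "distinct \<pi>"
    by (auto simp: permutations_of_set_def)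
  define s where "s v x = (if x < v then x else x + 1)" for v x :: nat
  define f where "f v = map (s v) \<pi> @ [v]" for v
  have "f ` {1..n + 1} \<subseteq> {\<rho> \<in> n_permutations (n + 1). covers \<rho> \<pi>}"
  proof (clarify, intro CollectI conjI)
    fix v assume v: "v \<in> {1..n + 1}"
    have inj: "inj_on (s v) A" for A
      by (auto simp: inj_on_def s_def split: if_splits)
    have "distinct (f v)"
      using sp inj by (auto simp: f_def distinct_map s_def split: if_splits)
    moreover have "set (f v) \<subseteq> {1..n + 1}"
      using sp v by (auto simp: f_def s_def)
    moreover have "length (f v) = n + 1"
      using sp distinct_card[of \<pi>] by (simp add: f_def)
    ultimately have "set (f v) = {1..n + 1}"
      by (intro card_subset_eq) (auto simp: distinct_card)
    with \<open>distinct (f v)\<close> show "f v \<in> n_permutations (n + 1)"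
      by (simp add: permutations_of_set_def)
    have "order_isomorphic (map (s v) \<pi>) \<pi>"
      by (auto simp: order_isomorphic_def s_def)
    then show "covers (f v) \<pi>"
      unfolding covers_def f_def by (intro exI[of _ "map (s v) \<pi>"]) auto
  qed
  moreover have "finite {\<rho> \<in> n_permutations (n + 1). covers \<rho> \<pi>}"
    by simp
  moreover have "inj_on f {1..n + 1}"
    by (auto simp: inj_on_def f_def)
  ultimately have "card {1..n + 1} \<le> card {\<rho> \<in> n_permutations (n + 1). covers \<rho> \<pi>}"
    by (metis card_image card_mono)
  with assms show "l \<le> card {\<rho> \<in> n_permutations (n + 1). covers \<rho> \<pi>}"
    by simp
qed

end

(* Put every (n+1)-permutation into A independently with probability
   p = (ln n + (l-1) ln ln n) / n^2.  Every n-permutation is covered by at least n^2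
   permutations, and the exponential Markov inequality
   P(|A \<inter> C| < l) \<le> x^(1-l) E x^|A \<inter> C| with x = 1 / ln n
   shows that it is covered fewer than l times with probability O(1/n).  Adding at most l
   permutations for each such n-permutation costs O(n!/n), which disappears in the O(1). *)
theory Submission
  imports Defs
begin

section \<open>Multiple covers by alteration of a random set\<close>

text \<open>For \<open>A\<close> inside a finite \<open>X\<close> and \<open>p\<close> in [0,1]: the
  probability that the random set equals \<open>A\<close>. Expectations are thus finite sums over
  \<open>Pow X\<close>.\<close>

definition subset_weight :: "real \<Rightarrow> 'a set \<Rightarrow> 'a set \<Rightarrow> real" where
  "subset_weight p X A = (\<Prod>a\<in>A. p) * (\<Prod>a\<in>X - A. 1 - p)"

lemma subset_weight_nonneg:
  assumes "0 \<le> p" "p \<le> 1"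
  shows "0 \<le> subset_weight p X A"
  using assms by (simp add: subset_weight_def)

text \<open>Generating function of a binomial variable: an element of \<open>C\<close> contributes
  the factor p*x + (1-p), any other element of \<open>X\<close> the factor 1. Expanding the product
  over \<open>X\<close> by \<open>prod_add\<close> gives one term per subset.\<close>

lemma sum_subset_weight_power:
  fixes p x :: real
  assumes "finite X" "C \<subseteq> X"
  shows "(\<Sum>A\<in>Pow X. subset_weight p X A * x ^ card (A \<inter> C)) = (1 - p * (1 - x)) ^ card C"
proof -
  have fin: "finite A" if "A \<subseteq> X" for A
    using that assms finite_subset by blast
  have ind: "(\<Prod>a\<in>A. if a \<in> C then y else 1) = y ^ card (A \<inter> C)" if "A \<subseteq> X" for A and y :: real
    using fin[OF that] by (simp add: prod.If_cases Int_def)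
  have "(1 - p * (1 - x)) ^ card C = (\<Prod>a\<in>X. if a \<in> C then 1 - p * (1 - x) else 1)"
    using ind[of X "1 - p * (1 - x)"] assms by (simp add: Int_absorb1)
  also have "\<dots> = (\<Prod>a\<in>X. p * (if a \<in> C then x else 1) + (1 - p))"
    by (intro prod.cong) (auto simp: algebra_simps)
  also have "\<dots> = (\<Sum>A\<in>Pow X. (\<Prod>a\<in>A. p * (if a \<in> C then x else 1)) * (\<Prod>a\<in>X - A. 1 - p))"
    by (rule prod_add) (use assms in auto)
  also have "\<dots> = (\<Sum>A\<in>Pow X. subset_weight p X A * x ^ card (A \<inter> C))"
    by (intro sum.cong) (auto simp: prod.distrib ind subset_weight_def)
  finally show ?thesis ..
qed

lemma sum_subset_weight:
  assumes "finite X"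
  shows "(\<Sum>A\<in>Pow X. subset_weight p X A) = 1"
  using sum_subset_weight_power[of X "{}" p 1] assms by simp

text \<open>Linearity of expectation: the cardinality is a sum of indicators, and each element is
  chosen with probability \<open>p\<close>.\<close>

lemma sum_subset_weight_card:
  assumes "finite X"
  shows "(\<Sum>A\<in>Pow X. subset_weight p X A * real (card A)) = p * real (card X)"
proof -
  have single: "(\<Sum>A\<in>Pow X. if a \<in> A then subset_weight p X A else 0) = p" if "a \<in> X" for a
  proof -
    have "p = (\<Prod>b\<in>X. if b = a then p else 1)"
      using assms that by simp
    \<comment> \<open>With 1-p replaced by 0 at \<open>a\<close>, the expansion loses exactly the
      subsets that omit \<open>a\<close>.\<close>
    also have "\<dots> = (\<Prod>b\<in>X. p + (if b = a then 0 else 1 - p))"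
      by (intro prod.cong) auto
    also have "\<dots> = (\<Sum>A\<in>Pow X. (\<Prod>b\<in>A. p) * (\<Prod>b\<in>X - A. if b = a then 0 else 1 - p))"
      by (rule prod_add) (use assms in auto)
    also have "\<dots> = (\<Sum>A\<in>Pow X. if a \<in> A then subset_weight p X A else 0)"
    proof (intro sum.cong refl)
      fix A assume "A \<in> Pow X"
      show "(\<Prod>b\<in>A. p) * (\<Prod>b\<in>X - A. if b = a then 0 else 1 - p) =
        (if a \<in> A then subset_weight p X A else 0)"
      proof (cases "a \<in> A")
        case True
        then have "(\<Prod>b\<in>X - A. if b = a then 0 else 1 - p) = (\<Prod>b\<in>X - A. 1 - p)"
          by (intro prod.cong) auto
        with True show ?thesis by (simp only: subset_weight_def if_True)
      next
        case False
        then have "(\<Prod>b\<in>X - A. if b = a then 0 else 1 - p) = 0"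
          using that assms by (intro prod_zero) auto
        with False show ?thesis by simp
      qed
    qed
    finally show ?thesis ..
  qed
  have "(\<Sum>A\<in>Pow X. subset_weight p X A * real (card A)) =
      (\<Sum>A\<in>Pow X. \<Sum>a\<in>X. if a \<in> A then subset_weight p X A else 0)"
  proof (intro sum.cong refl)
    fix A assume "A \<in> Pow X"
    then have "X \<inter> A = A" by auto
    then show "subset_weight p X A * real (card A) =
        (\<Sum>a\<in>X. if a \<in> A then subset_weight p X A else 0)"
      using assms by (simp add: sum.If_cases)
  qed
  also have "\<dots> = (\<Sum>a\<in>X. \<Sum>A\<in>Pow X. if a \<in> A then subset_weight p X A else 0)"
    by (rule sum.swap)
  also have "\<dots> = p * real (card X)"
    by (simp add: single)
  finally show ?thesis .
qed

text \<open>If \<open>f\<close> exceeded its mean everywhere, the nonnegative terms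
  \<open>w s * (f s - ?m)\<close> would sum to 0, so all weights would vanish, although their sum is
  1.\<close>

lemma exists_le_weighted_mean:
  fixes w f :: "'a \<Rightarrow> real"
  assumes "finite S" "\<And>s. s \<in> S \<Longrightarrow> 0 \<le> w s" "sum w S = 1"
  shows "\<exists>s\<in>S. f s \<le> (\<Sum>s\<in>S. w s * f s)"
proof (rule ccontr)
  let ?m = "\<Sum>s\<in>S. w s * f s"
  assume "\<not> ?thesis"
  then have less: "?m < f s" if "s \<in> S" for s
    using that by force
  have "(\<Sum>s\<in>S. w s * (f s - ?m)) = ?m - sum w S * ?m"
    by (simp add: right_diff_distrib sum_subtractf sum_distrib_right)
  then have "(\<Sum>s\<in>S. w s * (f s - ?m)) = 0"
    using assms by simp
  then have "\<forall>s\<in>S. w s * (f s - ?m) = 0"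
    using assms less by (subst (asm) sum_nonneg_eq_0_iff) (auto intro!: mult_nonneg_nonneg simp: less_imp_le)
  then have "\<forall>s\<in>S. w s = 0"
    using less by fastforce
  with assms show False by simp
qed

lemma exists_multicover:
  fixes C :: "'i \<Rightarrow> 'a set" and p x :: real
  assumes "finite X" "finite I"
    and C: "\<And>i. i \<in> I \<Longrightarrow> C i \<subseteq> X" "\<And>i. i \<in> I \<Longrightarrow> N \<le> card (C i)"
    and "1 \<le> l" "l \<le> N" and p: "0 \<le> p" "p \<le> 1" and x: "0 < x" "x \<le> 1"
  shows "\<exists>A\<subseteq>X. (\<forall>i\<in>I. l \<le> card (A \<inter> C i)) \<and>
    real (card A) \<le> p * real (card X) +
      real l * (real (card I) * ((1 / x) ^ (l - 1) * (1 - p * (1 - x)) ^ N))"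
proof -
  let ?q = "1 - p * (1 - x)"
  let ?w = "subset_weight p X"
  \<comment> \<open>The size of \<open>A\<close> plus an upper bound for the cost of repairing it;
    averaging the two together yields one \<open>A\<close> for which the total is small.\<close>
  let ?f = "\<lambda>A. real (card A) + (\<Sum>i\<in>I. real l * (1 / x) ^ (l - 1) * x ^ card (A \<inter> C i))"
  have "p * (1 - x) \<le> 1 * 1" "0 \<le> p * (1 - x)"
    using p x by (intro mult_mono mult_nonneg_nonneg; simp)+
  then have q: "0 \<le> ?q" "?q \<le> 1" by auto
  have "(\<Sum>A\<in>Pow X. ?w A * ?f A) = (\<Sum>A\<in>Pow X. ?w A * real (card A)) +
      (\<Sum>A\<in>Pow X. \<Sum>i\<in>I. real l * (1 / x) ^ (l - 1) * (?w A * x ^ card (A \<inter> C i)))"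
    by (simp only: distrib_left sum.distrib sum_distrib_left mult.left_commute)
  also have "\<dots> = p * real (card X) +
      (\<Sum>i\<in>I. \<Sum>A\<in>Pow X. real l * (1 / x) ^ (l - 1) * (?w A * x ^ card (A \<inter> C i)))"
    using sum_subset_weight_card[OF \<open>finite X\<close>] by (simp only: sum.swap[of _ I])
  also have "\<dots> = p * real (card X) + (\<Sum>i\<in>I. real l * (1 / x) ^ (l - 1) * ?q ^ card (C i))"
    using \<open>finite X\<close> C by (simp only: sum_distrib_left[symmetric] sum_subset_weight_power cong: sum.cong)
  \<comment> \<open>Since \<open>?q\<close> lies in [0,1], having more than \<open>N\<close>
    elements in \<open>C i\<close> only lowers the power.\<close>
  also have "\<dots> \<le> p * real (card X) + (\<Sum>i\<in>I. real l * (1 / x) ^ (l - 1) * ?q ^ N)"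
    using q C x by (intro add_left_mono sum_mono mult_left_mono power_decreasing) auto
  finally have mean: "(\<Sum>A\<in>Pow X. ?w A * ?f A) \<le> p * real (card X) +
      real l * (real (card I) * ((1 / x) ^ (l - 1) * ?q ^ N))"
    by (simp add: algebra_simps)
  obtain A where A: "A \<subseteq> X" and fA: "?f A \<le> (\<Sum>A\<in>Pow X. ?w A * ?f A)"
    using exists_le_weighted_mean[of "Pow X" ?w ?f] subset_weight_nonneg[OF p]
      sum_subset_weight[OF \<open>finite X\<close>] \<open>finite X\<close> by auto
  \<comment> \<open>The indices that \<open>A\<close> leaves deficient. Each receives a full block
    \<open>B i\<close> of \<open>l\<close> elements, so the repair costs at most \<open>l\<close>
    per index, whatever \<open>A\<close> already contains.\<close>
  define D where "D = {i \<in> I. card (A \<inter> C i) < l}"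
  have "finite D" "D \<subseteq> I" using \<open>finite I\<close> by (auto simp: D_def)
  have "\<forall>i\<in>I. \<exists>B\<subseteq>C i. card B = l"
    using C(2) \<open>l \<le> N\<close> obtain_subset_with_card_n by (metis le_trans)
  then obtain B where B: "\<And>i. i \<in> I \<Longrightarrow> B i \<subseteq> C i" "\<And>i. i \<in> I \<Longrightarrow> card (B i) = l"
    by metis
  define A' where "A' = A \<union> (\<Union>i\<in>D. B i)"
  have sub: "A' \<subseteq> X"
    unfolding A'_def using A B(1) C(1) \<open>D \<subseteq> I\<close> by (intro Un_least UN_least) blast+
  then have "finite A'" using \<open>finite X\<close> finite_subset by blast
  have cover: "l \<le> card (A' \<inter> C i)" if "i \<in> I" for i
  proof (cases "i \<in> D")
    case True
    then have "B i \<subseteq> A' \<inter> C i" using B that by (auto simp: A'_def)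
    then show ?thesis using B(2)[OF that] \<open>finite A'\<close> card_mono by (metis finite_Int)
  next
    case False
    then have "l \<le> card (A \<inter> C i)" using that by (simp add: D_def)
    also have "\<dots> \<le> card (A' \<inter> C i)"
      using \<open>finite A'\<close> by (intro card_mono) (auto simp: A'_def)
    finally show ?thesis .
  qed
  have "card A' \<le> card A + card (\<Union>i\<in>D. B i)"
    unfolding A'_def by (rule card_Un_le)
  also have "card (\<Union>i\<in>D. B i) \<le> (\<Sum>i\<in>D. card (B i))"
    by (rule card_UN_le) fact
  also have "\<dots> = (\<Sum>i\<in>D. l)"
    using B \<open>D \<subseteq> I\<close> by (intro sum.cong) auto
  finally have "real (card A') \<le> real (card A) + (\<Sum>i\<in>D. real l)"
    by (simp flip: of_nat_mult of_nat_add)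
  \<comment> \<open>Pointwise form of the Markov bound: a deficient index meets \<open>A\<close> in
    at most l-1 elements, and x \<le> 1, so its summand is at least \<open>l\<close>.\<close>
  also have "(\<Sum>i\<in>D. real l) \<le> (\<Sum>i\<in>D. real l * (1 / x) ^ (l - 1) * x ^ card (A \<inter> C i))"
  proof (intro sum_mono)
    fix i assume "i \<in> D"
    then have "card (A \<inter> C i) \<le> l - 1" by (auto simp: D_def)
    then have "x ^ (l - 1) \<le> x ^ card (A \<inter> C i)"
      using x by (intro power_decreasing) auto
    then have "1 \<le> (1 / x) ^ (l - 1) * x ^ card (A \<inter> C i)"
      using x by (simp add: power_one_over divide_simps)
    then have "real l * 1 \<le> real l * ((1 / x) ^ (l - 1) * x ^ card (A \<inter> C i))"
      by (intro mult_left_mono) auto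
    then show "real l \<le> real l * (1 / x) ^ (l - 1) * x ^ card (A \<inter> C i)"
      by (simp add: mult.assoc)
  qed
  also have "\<dots> \<le> (\<Sum>i\<in>I. real l * (1 / x) ^ (l - 1) * x ^ card (A \<inter> C i))"
    using \<open>finite I\<close> \<open>D \<subseteq> I\<close> x by (intro sum_mono2) auto
  finally show ?thesis
    using fA mean sub cover by (intro exI[of _ A']) auto
qed

section \<open>Counting the permutations that cover a given one\<close>

text \<open>The increasing map whose image omits exactly \<open>v\<close>; it makes room for a new
  entry \<open>v\<close>.\<close>

definition shift_up :: "nat \<Rightarrow> nat \<Rightarrow> nat" where
  "shift_up v x = (if x < v then x else x + 1)"

text \<open>For \<open>i\<close> up to the length of the word, this reverses deleting the entry
  \<open>v\<close> at position \<open>i\<close> (counted from 0) and closing the gap in the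
  values.\<close>

definition insert_value :: "nat list \<Rightarrow> nat \<Rightarrow> nat \<Rightarrow> nat list" where
  "insert_value \<pi> i v = map (shift_up v) (take i \<pi>) @ v # map (shift_up v) (drop i \<pi>)"

lemma shift_up_inject [simp]: "shift_up v x = shift_up v y \<longleftrightarrow> x = y"
  by (auto simp: shift_up_def)

lemma shift_up_neq [simp]: "shift_up v x \<noteq> v" "v \<noteq> shift_up v x"
  by (auto simp: shift_up_def)

lemma length_insert_value [simp]: "length (insert_value \<pi> i v) = Suc (length \<pi>)"
  by (simp add: insert_value_def)

lemma nth_insert_value:
  assumes "i \<le> length \<pi>" "k \<le> length \<pi>"
  shows "insert_value \<pi> i v ! k =
    (if k < i then shift_up v (\<pi> ! k) else if k = i then v else shift_up v (\<pi> ! (k - 1)))"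
  using assms by (auto simp: insert_value_def nth_append nth_Cons' min_def)

lemma insert_value_permutation:
  assumes "\<pi> \<in> n_permutations n" "v \<in> {1..n + 1}"
  shows "insert_value \<pi> i v \<in> n_permutations (n + 1)"
proof -
  have \<pi>: "set \<pi> = {1..n}" "distinct \<pi>" "length \<pi> = n"
    using assms length_finite_permutations_of_set[of \<pi>] by (auto simp: permutations_of_set_def)
  have "set (take i \<pi>) \<union> set (drop i \<pi>) = set \<pi>"
    by (simp flip: set_append)
  then have set_eq: "set (insert_value \<pi> i v) = insert v (shift_up v ` set \<pi>)"
    by (simp add: insert_value_def flip: image_Un)
  \<comment> \<open>As many values as positions: this forces distinctness, and also makes the value
    set all of {1..n+1}.\<close>
  have card: "card (set (insert_value \<pi> i v)) = n + 1"
    unfolding set_eq using \<pi>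
    by (subst card_insert_disjoint) (auto simp: card_image inj_on_def distinct_card)
  then have "distinct (insert_value \<pi> i v)"
    using \<pi> by (intro card_distinct) simp
  moreover have "set (insert_value \<pi> i v) = {1..n + 1}"
    using card assms(2) \<pi> unfolding set_eq
    by (intro card_subset_eq) (auto simp: shift_up_def)
  ultimately show ?thesis by (simp add: permutations_of_set_def)
qed

lemma covers_insert_value: "covers (insert_value \<pi> i v) \<pi>"
proof -
  have "map (shift_up v) \<pi> = map (shift_up v) (take i \<pi>) @ map (shift_up v) (drop i \<pi>)"
    by (metis append_take_drop_id map_append)
  then have "subseq (map (shift_up v) \<pi>) (insert_value \<pi> i v)"
    unfolding insert_value_def by (simp only:) (intro list_emb_append_mono subseq_order.refl list_emb_Cons)
  moreover have "order_isomorphic (map (shift_up v) \<pi>) \<pi>"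
    by (auto simp: order_isomorphic_def shift_up_def)
  ultimately show ?thesis unfolding covers_def by blast
qed

text \<open>The same permutation arises twice only by inserting next to a neighbour of adjacent value,
  so for each position after the first we forbid the two values that are adjacent to the
  preceding entry after shifting.\<close>

definition insertions :: "nat list \<Rightarrow> (nat \<times> nat) set" where
  "insertions \<pi> = (SIGMA i:{..length \<pi>}. {1..length \<pi> + 1} -
     (if i = 0 then {} else {\<pi> ! (i - 1), \<pi> ! (i - 1) + 1}))"

text \<open>Position 0 allows n+1 values, and each of the n later positions loses at most two of
  them, leaving at least n-1. The total is at least n+1 + n(n-1) = n^2+1 for n \<ge> 1.\<close>

lemma card_insertions_ge: "(length \<pi>)\<^sup>2 \<le> card (insertions \<pi>)"
proof -
  let ?n = "length \<pi>"
  let ?F = "\<lambda>i. if i = 0 then {} else {\<pi> ! (i - 1), \<pi> ! (i - 1) + 1}"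
  have "(if i = 0 then ?n + 1 else ?n - 1) \<le> card ({1..?n + 1} - ?F i)" for i
  proof (cases "i = 0")
    case False
    have "card (?F i) \<le> 2" by (auto simp: card_insert_if)
    moreover have "card {1..?n + 1} - card (?F i) \<le> card ({1..?n + 1} - ?F i)"
      by (rule diff_card_le_card_Diff) auto
    moreover have "card {1..?n + 1} = ?n + 1" by simp
    ultimately show ?thesis unfolding if_not_P[OF False] by linarith
  qed simp
  then have "(\<Sum>i\<le>?n. if i = 0 then ?n + 1 else ?n - 1) \<le> (\<Sum>i\<le>?n. card ({1..?n + 1} - ?F i))"
    by (intro sum_mono)
  also have "\<dots> = card (insertions \<pi>)"
    unfolding insertions_def by (subst card_SigmaI) auto
  also have "(\<Sum>i\<le>?n. if i = 0 then ?n + 1 else ?n - 1) = ?n + 1 + ?n * (?n - 1)"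
    by (subst sum.atMost_shift) simp
  finally show ?thesis
    by (cases ?n) (auto simp: power2_eq_square algebra_simps)
qed

text \<open>Compare the words at position \<open>j\<close>. One has \<open>w\<close> there; the
  other, with its insertion further left, has the shifted entry \<open>\<pi> ! (j - 1)\<close>,
  which is one of the two values forbidden to \<open>w\<close>.\<close>

lemma insert_value_neq:
  assumes "(j, w) \<in> insertions \<pi>" "i < j"
  shows "insert_value \<pi> i v \<noteq> insert_value \<pi> j w"
proof
  assume eq: "insert_value \<pi> i v = insert_value \<pi> j w"
  have j: "j \<le> length \<pi>" "w \<noteq> \<pi> ! (j - 1)" "w \<noteq> \<pi> ! (j - 1) + 1"
    using assms by (auto simp: insertions_def)
  have "w = insert_value \<pi> j w ! j"
    using j by (simp add: nth_insert_value)
  also have "\<dots> = shift_up v (\<pi> ! (j - 1))"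
    using j assms(2) by (simp flip: eq add: nth_insert_value)
  finally show False using j by (auto simp: shift_up_def split: if_splits)
qed

lemma inj_on_insert_value: "inj_on (\<lambda>(i, v). insert_value \<pi> i v) (insertions \<pi>)"
proof (rule inj_onI, clarify)
  fix i v j w
  assume iv: "(i, v) \<in> insertions \<pi>" and jw: "(j, w) \<in> insertions \<pi>"
    and eq: "insert_value \<pi> i v = insert_value \<pi> j w"
  have "i = j"
    using insert_value_neq[OF iv, of j w] insert_value_neq[OF jw, of i v] eq
    by (metis linorder_neqE_nat)
  moreover have "v = insert_value \<pi> i v ! i" "w = insert_value \<pi> j w ! j"
    using iv jw by (auto simp: nth_insert_value insertions_def)
  ultimately show "i = j \<and> v = w" using eq by metis
qed

lemma card_covers_ge:
  assumes "\<pi> \<in> n_permutations n"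
  shows "n\<^sup>2 \<le> card {\<rho> \<in> n_permutations (n + 1). covers \<rho> \<pi>}"
proof -
  have n: "length \<pi> = n"
    using length_finite_permutations_of_set[OF assms] by simp
  have "n\<^sup>2 \<le> card ((\<lambda>(i, v). insert_value \<pi> i v) ` insertions \<pi>)"
    using card_insertions_ge[of \<pi>] n by (simp add: card_image[OF inj_on_insert_value])
  also have "\<dots> \<le> card {\<rho> \<in> n_permutations (n + 1). covers \<rho> \<pi>}"
  proof (rule card_mono)
    show "(\<lambda>(i, v). insert_value \<pi> i v) ` insertions \<pi> \<subseteq>
        {\<rho> \<in> n_permutations (n + 1). covers \<rho> \<pi>}"
      using insert_value_permutation[OF assms] covers_insert_value n
      by (auto simp: insertions_def simp del: One_nat_def)
  qed simp
  finally show ?thesis .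
qed

section \<open>The asymptotic bound\<close>

text \<open>The alteration bound with (n+1)-permutations as ground set, n-permutations as indices
  and N = n^2; \<open>p\<close> and \<open>x\<close> stay free to be optimised.\<close>

lemma kappa_le_random:
  fixes p x :: real
  assumes "1 \<le> l" "l \<le> n\<^sup>2" "0 \<le> p" "p \<le> 1" "0 < x" "x \<le> 1"
  shows "real (kappa n l) \<le> p * fact (n + 1) +
    real l * (fact n * ((1 / x) ^ (l - 1) * (1 - p * (1 - x)) ^ n\<^sup>2))"
proof -
  let ?X = "n_permutations (n + 1)" and ?I = "n_permutations n"
  let ?C = "\<lambda>\<pi>. {\<rho> \<in> ?X. covers \<rho> \<pi>}"
  obtain A where A: "A \<subseteq> ?X" "\<And>\<pi>. \<pi> \<in> ?I \<Longrightarrow> l \<le> card (A \<inter> ?C \<pi>)"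
    and card: "real (card A) \<le> p * real (card ?X) +
      real l * (real (card ?I) * ((1 / x) ^ (l - 1) * (1 - p * (1 - x)) ^ n\<^sup>2))"
    using exists_multicover[of ?X ?I ?C "n\<^sup>2" l p x] assms card_covers_ge by auto
  have "A \<inter> ?C \<pi> = {\<rho> \<in> A. covers \<rho> \<pi>}" for \<pi>
    using A(1) by auto
  then have "covering_family n l A"
    using A by (simp add: covering_family_def)
  then have "kappa n l \<le> card A"
    unfolding kappa_def by (intro Least_le) auto
  then show ?thesis using card by (simp del: fact_Suc)
qed

lemma kappa_le:
  assumes "1 \<le> l" "l \<le> n" and ln_n: "1 \<le> ln (real n)"
  shows "real (kappa n l) \<le> fact (n + 1) / (real n)\<^sup>2 *
    (ln (real n) + (real l - 1) * ln (ln (real n)) + real l * exp (real l))"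
proof -
  define L where "L = ln (real n)"
  \<comment> \<open>Chosen so that exp(-u) = 1 / (n * L^(l-1)), which cancels the factor (1/x)^(l-1)
    = L^(l-1) arising from x = 1/L.\<close>
  define u where "u = L + (real l - 1) * ln L"
  define p where "p = u / (real n)\<^sup>2"
  have n: "1 \<le> n" using assms by simp
  have L: "1 \<le> L" "L \<le> real n" "exp L = real n"
    using ln_n n ln_le_minus_one[of "real n"] by (auto simp: L_def)
  have lnL: "0 \<le> ln L" "ln L \<le> L"
    using L ln_le_minus_one[of L] by auto
  \<comment> \<open>The resulting bound u \<le> l*L serves twice: it gives p \<le> 1, and it bounds
    u/L by \<open>l\<close> in the exponent below.\<close>
  have "(real l - 1) * ln L \<le> (real l - 1) * L" "0 \<le> (real l - 1) * ln L"
    using lnL assms by (auto intro!: mult_left_mono)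
  then have u: "0 \<le> u" "u \<le> real l * L"
    using L by (auto simp: u_def algebra_simps)
  have "real l * L \<le> real n * real n"
    using L assms by (intro mult_mono) auto
  then have p: "0 \<le> p" "p \<le> 1"
    using u n by (auto simp: p_def power2_eq_square divide_simps)
  have "l \<le> n\<^sup>2"
    using assms n by (metis le_trans self_le_power one_le_numeral zero_less_numeral)
  have "(1 - p * (1 - 1 / L)) ^ n\<^sup>2 \<le> exp (- (p * (1 - 1 / L))) ^ n\<^sup>2"
  proof (intro power_mono)
    show "1 - p * (1 - 1 / L) \<le> exp (- (p * (1 - 1 / L)))"
      using exp_ge_add_one_self[of "- (p * (1 - 1 / L))"] by simp
    have "p * (1 - 1 / L) \<le> 1 * 1"
      using p L by (intro mult_mono) auto
    then show "0 \<le> 1 - p * (1 - 1 / L)" by simp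
  qed
  \<comment> \<open>Taking x = 1/L instead of 0 adds only u/L to the exponent, hence costs at most
    the constant factor exp(l).\<close>
  also have "\<dots> = exp (u / L - u)"
    using n by (simp flip: exp_of_nat_mult add: p_def field_simps)
  also have "\<dots> \<le> exp (real l - u)"
    using u L by (simp add: pos_divide_le_eq)
  also have "\<dots> = exp (real l) / (real n * L ^ (l - 1))"
  proof -
    have "exp ((real l - 1) * ln L) = L ^ (l - 1)"
      using L assms exp_of_nat_mult[of "l - 1" "ln L"] by (simp add: of_nat_diff)
    then show ?thesis by (simp add: exp_diff u_def exp_add L)
  qed
  finally have "L ^ (l - 1) * (1 - p * (1 - 1 / L)) ^ n\<^sup>2 \<le> 
      L ^ (l - 1) * (exp (real l) / (real n * L ^ (l - 1)))"
    using L by (intro mult_left_mono) auto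
  also have "\<dots> = exp (real l) / real n"
    using L by simp
  finally have "real l * (fact n * (L ^ (l - 1) * (1 - p * (1 - 1 / L)) ^ n\<^sup>2)) \<le>
      real l * (fact n * (exp (real l) / real n))"
    by (intro mult_left_mono) auto
  moreover have "real (kappa n l) \<le> p * fact (n + 1) +
      real l * (fact n * (L ^ (l - 1) * (1 - p * (1 - 1 / L)) ^ n\<^sup>2))"
    using kappa_le_random[of l n p "1 / L"] assms p L \<open>l \<le> n\<^sup>2\<close> by simp
  \<comment> \<open>Rewrites the repair cost in units of (n+1)!/n^2, using n * n! \<le> (n+1)!; it
    then enters the bracket as the constant l * exp(l).\<close>
  moreover have "fact n * (exp (real l) / real n) \<le> fact (n + 1) / (real n)\<^sup>2 * exp (real l)"
    using n by (simp add: field_simps power2_eq_square)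
  then have "real l * (fact n * (exp (real l) / real n)) \<le>
      real l * (fact (n + 1) / (real n)\<^sup>2 * exp (real l))"
    by (intro mult_left_mono) auto
  ultimately have "real (kappa n l) \<le>
      p * fact (n + 1) + real l * (fact (n + 1) / (real n)\<^sup>2 * exp (real l))"
    by linarith
  also have "\<dots> = fact (n + 1) / (real n)\<^sup>2 * (u + real l * exp (real l))"
    by (simp add: p_def distrib_left mult.left_commute del: fact_Suc)
  finally show ?thesis by (simp add: u_def L_def)
qed

theorem theorem3:
  fixes l :: nat
  assumes "l \<ge> 2"
  shows "\<exists>E :: nat \<Rightarrow> real. E \<in> O(\<lambda>n. 1) \<and>
    (\<forall>\<^sub>F n in sequentially.
       real (kappa n l) \<le>
         fact (n + 1) / (real n)\<^sup>2 * (ln (real n) + (real l - 1) * ln (ln (real n)) + E n))"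
proof (intro exI conjI)
  \<comment> \<open>The error term is constant in n; large n is required only for ln n \<ge> 1 and n
    \<ge> l.\<close>
  show "(\<lambda>n. real l * exp (real l)) \<in> O(\<lambda>n::nat. 1)" by simp
  have "filterlim (\<lambda>n. ln (real n)) at_top sequentially"
    by (rule filterlim_compose[OF ln_at_top filterlim_real_sequentially])
  then have "\<forall>\<^sub>F n in sequentially. 1 \<le> ln (real n)"
    by (simp add: filterlim_at_top)
  then show "\<forall>\<^sub>F n in sequentially. real (kappa n l) \<le> fact (n + 1) / (real n)\<^sup>2 *
      (ln (real n) + (real l - 1) * ln (ln (real n)) + real l * exp (real l))"
    using eventually_ge_at_top[of l] by eventually_elim (use assms kappa_le in auto)
qed

end
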